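(* Consider a linear cake-eating problem on $X=[0,b]$, $b>0$, with coefficients $\langle p^{(t)}\mid t\in\mathbb{N}^0\rangle$, and let $T\in\mathbb{N}^0$. (i) If $p^{(T)}\ge0$, then for all $x,y\in X$, $y\ge x$ implies $V^T(y)\ge V^T(x)$, and thus $V^T(b)\ge V^T(x)\ge V^T(0)$ for all $x\in X$. (ii) If $p^{(T)}>0$, then for all $x,y\in X$, $y>x$ implies $V^T(y)>V^T(x)$. (iii) Suppose $p^{(T)}\le0$. If for $x,y\in X$ such that $y\ge x$ there exists $\langle y_t\mid t\ge T\rangle\in\mathcal{S}^T(y)$ satisfying $y_{T+1}\le x$, then $V^T(y)\le V^T(x)$, and thus $V^T(b)\le V^T(x)\ge V^T(0)$ for all $x\in X$. (iv) Suppose $p^{(T)}<0$. If for $x,y\in X$ such that $y>x$ there exists $\langle y_t\mid t\ge T\rangle\in\mathcal{S}^T(y)$ satisfying $y_{T+1}\le x$, then $V^T(y)<V^T(x)$. (v) $D^-V^T(x)$ and $D^+V^T(x)$ exist for all $x\in(0,b)$, both $D^-V^T(x)$ and $D^+V^T(x)$ are non-increasing for $x\in(0,b)$, and for all $x\in(0,b)$, $V^T(y)-D^-V^T(x)\,y\le V^T(x)-D^-V^T(x)\,x$ for all $y\in X$. (vi) If $p^{(T)}\ge0$, then $D^-V^T(b)$ exists, $D^-V^T(b)\ge0$, $D^-V^T(x)\ge D^-V^T(b)$ for all $x\in(0,b]$, and $V^T(y)-D^-V^T(b)\,y\le V^T(b)-D^-V^T(b)\,b$ for all $y\in X$.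
   Context: $\mathbb{N}^0=\{0,1,2,\dots\}$. A linear cake-eating problem on $X=[0,b]$ is given by a sequence of real numbers $\langle p^{(t)}\mid t\in\mathbb{N}^0\rangle$ with $\sum_{t=0}^\infty|p^{(t)}|<+\infty$, together with the constraint sets $\Omega_t=\Omega=\{(z,y)\mid z\in[0,b],\ y\in[0,z]\}$ for all $t\in\mathbb{N}^0$. For $T\in\mathbb{N}^0$ and $y\in X$, $\mathcal{F}^T(y)$ is the set of sequences $\langle x_t\mid t\ge T\rangle$ with $x_T=y$ and $(x_t,x_{t+1})\in\Omega$ (i.e. $0\le x_{t+1}\le x_t\le b$) for all $t\ge T$; $\mathcal{S}^T(y)$ is the set of maximizers of $\sum_{t=T}^\infty p^{(t)}x_t$ over $\langle x_t\mid t\ge T\rangle\in\mathcal{F}^T(y)$. The set $\mathcal{S}^T(y)$ is non-empty for every $y\in X$, and $V^T:X\to\mathbb{R}$ is defined by $V^T(y)=\sum_{t=T}^\infty p^{(t)}x_t$ for any $\langle x_t\mid t\ge T\rangle\in\mathcal{S}^T(y)$. $D^-V^T(x)$ and $D^+V^T(x)$ denote the left-hand and right-hand derivatives of $V^T$ at $x$.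
   Formalization: In (iii) the final chain is stated as V^T(b) ≤ V^T(x) ≤ V^T(0), assuming the solution condition for all pairs x ≤ y; the printed V^T(x) ≥ V^T(0) is false (b=1, T=0, p=(-1,0,0,…) gives V^0(y) = -y). *)

theory Defs
  imports Complex_Main
begin

definition cake_constraint :: "real \<Rightarrow> (real \<times> real) set" where
  "cake_constraint b = {(z, y). z \<in> {0..b} \<and> y \<in> {0..z}}"

text \<open>A sequence indexed by \<open>t \<ge> T\<close> is represented by a function on all of \<open>nat\<close>; its values
  at indices below \<open>T\<close> are unconstrained and enter neither feasibility nor the objective.\<close>

definition cake_feasible :: "real \<Rightarrow> nat \<Rightarrow> real \<Rightarrow> (nat \<Rightarrow> real) set" where
  "cake_feasible b T y = {x. x T = y \<and> (\<forall>t\<ge>T. (x t, x (Suc t)) \<in> cake_constraint b)}"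

definition cake_objective :: "(nat \<Rightarrow> real) \<Rightarrow> nat \<Rightarrow> (nat \<Rightarrow> real) \<Rightarrow> real" where
  "cake_objective p T x = (\<Sum>n. p (T + n) * x (T + n))"

definition cake_solutions ::
    "real \<Rightarrow> (nat \<Rightarrow> real) \<Rightarrow> nat \<Rightarrow> real \<Rightarrow> (nat \<Rightarrow> real) set" where
  "cake_solutions b p T y =
     {x \<in> cake_feasible b T y.
        \<forall>x' \<in> cake_feasible b T y. cake_objective p T x' \<le> cake_objective p T x}"

text \<open>All solutions have the same objective value, see \<open>cake_value_eq\<close> below. The value function
  is meaningful only for \<open>y \<in> {0..b}\<close>; for other \<open>y\<close> no sequence is feasible.\<close>

definition cake_value :: "real \<Rightarrow> (nat \<Rightarrow> real) \<Rightarrow> nat \<Rightarrow> real \<Rightarrow> real" where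
  "cake_value b p T y = (THE v. \<exists>x \<in> cake_solutions b p T y. v = cake_objective p T x)"

lemma cake_value_eq:
  assumes "x \<in> cake_solutions b p T y"
  shows "cake_value b p T y = cake_objective p T x"
  unfolding cake_value_def
proof (rule the_equality)
  show "\<exists>x' \<in> cake_solutions b p T y. cake_objective p T x = cake_objective p T x'"
    using assms by blast
next
  fix v assume "\<exists>x' \<in> cake_solutions b p T y. v = cake_objective p T x'"
  then show "v = cake_objective p T x"
    using assms unfolding cake_solutions_def by (auto intro: antisym)
qed

text \<open>The one-sided derivatives are meaningful only where they exist; existence is the separate
  assertion that some \<open>D\<close> satisfies \<open>(f has_real_derivative D) (at_left x)\<close>, respectively
  \<open>(at_right x)\<close>.\<close>

definition left_deriv :: "(real \<Rightarrow> real) \<Rightarrow> real \<Rightarrow> real" where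
  "left_deriv f x = (THE D. (f has_real_derivative D) (at_left x))"

definition right_deriv :: "(real \<Rightarrow> real) \<Rightarrow> real \<Rightarrow> real" where
  "right_deriv f x = (THE D. (f has_real_derivative D) (at_right x))"

end

theory Submission
  imports Defs "HOL-Analysis.Elementary_Metric_Spaces"
begin

text \<open>Rescaling a feasible sequence keeps it feasible, so the value function is linear on
  \<open>[0, b]\<close>. Its slope is the largest element of the set consisting of the non-empty partial sums of
  \<open>p T + p (T + 1) + \<dots>\<close> together with their limit; it bounds the objective by summation by parts,
  and is attained by holding the cake and then eating all of it at once (or never).\<close>

text \<open>Abel summation: each decrement of \<open>x\<close>, and finally the remainder
  \<open>x n\<close>, is weighted by a partial sum of \<open>q\<close>, hence by at most
  \<open>c\<close>; the decrements and the remainder are non-negative and telescope to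
  \<open>x 0\<close>.\<close>

lemma weighted_sum_decseq_le:
  fixes q x :: "nat \<Rightarrow> real"
  assumes "decseq x" and "\<And>n. 0 \<le> x n" and le: "\<And>n. (\<Sum>k\<le>n. q k) \<le> c"
  shows "(\<Sum>k\<le>n. q k * x k) \<le> c * x 0"
proof -
  \<comment> \<open>The last partial sum stays exact in the induction, since
    \<open>q (Suc n)\<close> may have either sign; replacing it by \<open>c\<close> too early would
    lose the step.\<close>
  have "(\<Sum>k\<le>n. q k * x k) \<le> c * (x 0 - x n) + (\<Sum>k\<le>n. q k) * x n"
  proof (induction n)
    case 0
    then show ?case by simp
  next
    case (Suc n)
    have "(\<Sum>k\<le>n. q k) * (x n - x (Suc n)) \<le> c * (x n - x (Suc n))"
      using le[of n] decseq_SucD[OF assms(1)] by (intro mult_right_mono) auto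
    with Suc show ?case by (simp add: algebra_simps)
  qed
  also have "\<dots> \<le> c * (x 0 - x n) + c * x n"
    using assms(2) le by (intro add_left_mono mult_right_mono)
  finally show ?thesis by (simp add: algebra_simps)
qed

text \<open>The range of a convergent sequence need not have a maximum, but becomes compact once the
  limit is added. The two cases for \<open>c\<close> later give two kinds of optimal plan.\<close>

lemma convergent_sup_attained:
  fixes P :: "nat \<Rightarrow> real"
  assumes "P \<longlonglongrightarrow> L"
  obtains c where "\<And>n. P n \<le> c" and "c = L \<or> (\<exists>n. c = P n)"
proof -
  obtain c where "c \<in> insert L (range P)" "\<forall>y\<in>insert L (range P). y \<le> c"
    using compact_attains_sup[OF compact_sequence_with_limit[OF assms]] by auto
  then show ?thesis using that by blast
qed

lemma cake_feasible_nonneg_le: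
  assumes "x \<in> cake_feasible b T y"
  shows "0 \<le> x (T + n)" and "x (T + n) \<le> b"
  using assms unfolding cake_feasible_def cake_constraint_def
  by (auto dest!: spec[of _ "T + n"])

lemma cake_feasible_decseq:
  assumes "x \<in> cake_feasible b T y"
  shows "decseq (\<lambda>n. x (T + n))"
  using assms unfolding cake_feasible_def cake_constraint_def decseq_Suc_iff by auto

lemma cake_objective_summable:
  assumes "summable (\<lambda>t. \<bar>p t\<bar>)" and "x \<in> cake_feasible b T y"
  shows "summable (\<lambda>n. p (T + n) * x (T + n))"
proof (rule summable_comparison_test')
  show "summable (\<lambda>n. \<bar>p (T + n)\<bar> * b)"
    using summable_ignore_initial_segment[OF assms(1), of T]
    by (intro summable_mult2) (simp add: add.commute)
  show "norm (p (T + n) * x (T + n)) \<le> \<bar>p (T + n)\<bar> * b" for n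
    using cake_feasible_nonneg_le[OF assms(2), of n] by (simp add: abs_mult mult_left_mono)
qed

text \<open>The bound on the objective is exported as well, so that a single feasible plan from
  \<open>x\<close> gives a lower estimate of \<open>c * x\<close>, the value at
  \<open>x\<close>.\<close>

lemma cake_value_linear:
  assumes p: "summable (\<lambda>t. \<bar>p t\<bar>)"
  obtains c where "p T \<le> c"
    and "\<And>y. y \<in> {0..b} \<Longrightarrow> cake_value b p T y = c * y"
    and "\<And>x y. x \<in> cake_feasible b T y \<Longrightarrow> cake_objective p T x \<le> c * y"
proof -
  define P where "P n = (\<Sum>k\<le>n. p (T + k))" for n
  have summ: "summable (\<lambda>n. p (T + n))"
    using summable_ignore_initial_segment[OF summable_rabs_cancel[OF p], of T]
    by (simp add: add.commute)
  then have "P \<longlonglongrightarrow> (\<Sum>n. p (T + n))"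
    unfolding P_def by (rule summable_LIMSEQ')
  then obtain c where le: "\<And>n. P n \<le> c" and att: "c = (\<Sum>n. p (T + n)) \<or> (\<exists>n. c = P n)"
    using convergent_sup_attained by metis
  have bound: "cake_objective p T x \<le> c * y" if x: "x \<in> cake_feasible b T y" for x y
  proof -
    have "(\<Sum>k\<le>n. p (T + k) * x (T + k)) \<le> c * x (T + 0)" for n
      using cake_feasible_decseq[OF x] cake_feasible_nonneg_le[OF x] le
      unfolding P_def by (intro weighted_sum_decseq_le)
    moreover have "x T = y"
      using x by (simp add: cake_feasible_def)
    ultimately show ?thesis
      unfolding cake_objective_def
      using LIMSEQ_le_const2[OF summable_LIMSEQ'[OF cake_objective_summable[OF p x]]] by auto
  qed
  have "cake_value b p T y = c * y" if y: "y \<in> {0..b}" for y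
  proof -
    obtain x where x: "x \<in> cake_feasible b T y" "cake_objective p T x = c * y"
      using att
    proof
      \<comment> \<open>The slope is the limit: the cake is never eaten, so the stock stays at
        \<open>y\<close>.\<close>
      assume "c = (\<Sum>n. p (T + n))"
      then show ?thesis
        using y summ that[of "\<lambda>_. y"]
        by (auto simp: cake_feasible_def cake_constraint_def cake_objective_def
            suminf_mult2[symmetric])
    next
      \<comment> \<open>The slope is a partial sum: the stock stays at \<open>y\<close> through time
        \<open>T + n\<close> and drops to 0 right after, which cuts the series off after its term
        \<open>n\<close>.\<close>
      assume "\<exists>n. c = P n"
      then obtain n where n: "c = P n" ..
      have "cake_objective p T (\<lambda>t. if t \<le> T + n then y else 0) = c * y"
        unfolding cake_objective_def n P_def sum_distrib_right
        by (subst suminf_finite[of "{..n}"]) auto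
      with y show ?thesis
        using that[of "\<lambda>t. if t \<le> T + n then y else 0"]
        by (auto simp: cake_feasible_def cake_constraint_def)
    qed
    then have "x \<in> cake_solutions b p T y"
      using bound by (auto simp: cake_solutions_def)
    with x show ?thesis by (simp add: cake_value_eq)
  qed
  \<comment> \<open>\<open>P\<close> sums up to and including its index, so \<open>P 0\<close> is
    \<open>p T\<close> and not the empty sum.\<close>
  moreover have "p T \<le> c"
    using le[of 0] by (simp add: P_def)
  ultimately show ?thesis using bound that by blast
qed

text \<open>From \<open>T\<close> on, only the constraint on the pair at times \<open>T\<close> and
  \<open>Suc T\<close> involves the changed entry.\<close>

lemma cake_feasible_lower_start:
  assumes "s \<in> cake_feasible b T y" and "x \<in> {0..b}" and "s (Suc T) \<le> x"
  shows "s(T := x) \<in> cake_feasible b T x"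
  using assms by (auto simp: cake_feasible_def cake_constraint_def)

lemma cake_objective_update_start:
  assumes "summable (\<lambda>t. \<bar>p t\<bar>)"
    and "s \<in> cake_feasible b T y" and "s(T := x) \<in> cake_feasible b T x"
  shows "cake_objective p T (s(T := x)) = cake_objective p T s + p T * (x - y)"
proof -
  have "s T = y"
    using assms(2) by (simp add: cake_feasible_def)
  then show ?thesis
    using suminf_split_head[OF cake_objective_summable[OF assms(1,2)]]
      suminf_split_head[OF cake_objective_summable[OF assms(1,3)]]
    by (simp add: cake_objective_def algebra_simps)
qed

lemma left_deriv_eqI:
  assumes "(f has_real_derivative D) (at_left x)"
  shows "left_deriv f x = D"
  unfolding left_deriv_def
  using assms tendsto_unique[OF trivial_limit_at_left_real]
  by (intro the_equality) (auto simp: has_field_derivative_iff)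

lemma right_deriv_eqI:
  assumes "(f has_real_derivative D) (at_right x)"
  shows "right_deriv f x = D"
  unfolding right_deriv_def
  using assms tendsto_unique[OF trivial_limit_at_right_real]
  by (intro the_equality) (auto simp: has_field_derivative_iff)

text \<open>Values just left of \<open>x\<close> suffice, so \<open>x = b\<close> is allowed, where
  nothing is known about \<open>f\<close> to the right.\<close>

lemma linear_has_left_derivative:
  fixes f :: "real \<Rightarrow> real"
  assumes "\<And>y. y \<in> {a..b} \<Longrightarrow> f y = c * y" and "x \<in> {a<..b}"
  shows "(f has_real_derivative c) (at_left x)"
proof -
  have "\<forall>\<^sub>F y in at_left x. f y = c * y"
    using eventually_at_left_real[of a x] assms by (auto elim!: eventually_mono)
  then have "(f has_real_derivative c) (at_left x) \<longleftrightarrow>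
      ((\<lambda>y. c * y) has_real_derivative c) (at_left x)"
    using assms by (intro has_field_derivative_cong_eventually) auto
  then show ?thesis
    by (auto intro!: derivative_eq_intros)
qed

lemma linear_has_right_derivative:
  fixes f :: "real \<Rightarrow> real"
  assumes "\<And>y. y \<in> {a..b} \<Longrightarrow> f y = c * y" and "x \<in> {a..<b}"
  shows "(f has_real_derivative c) (at_right x)"
proof -
  have "\<forall>\<^sub>F y in at_right x. f y = c * y"
    using eventually_at_right_real[of x b] assms by (auto elim!: eventually_mono)
  then have "(f has_real_derivative c) (at_right x) \<longleftrightarrow>
      ((\<lambda>y. c * y) has_real_derivative c) (at_right x)"
    using assms by (intro has_field_derivative_cong_eventually) auto
  then show ?thesis
    by (auto intro!: derivative_eq_intros)
qed

theorem proposition6p1: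
  fixes b :: real and p :: "nat \<Rightarrow> real" and T :: nat
  assumes "b > 0"
    and "summable (\<lambda>t. \<bar>p t\<bar>)"
  defines "V \<equiv> cake_value b p T"
  shows
    "(p T \<ge> 0 \<longrightarrow>
        (\<forall>x\<in>{0..b}. \<forall>y\<in>{0..b}. y \<ge> x \<longrightarrow> V y \<ge> V x) \<and>
        (\<forall>x\<in>{0..b}. V b \<ge> V x \<and> V x \<ge> V 0)) \<and>
     (p T > 0 \<longrightarrow>
        (\<forall>x\<in>{0..b}. \<forall>y\<in>{0..b}. y > x \<longrightarrow> V y > V x)) \<and>
     (p T \<le> 0 \<longrightarrow>
        (\<forall>x\<in>{0..b}. \<forall>y\<in>{0..b}. y \<ge> x \<longrightarrow>
           (\<exists>s\<in>cake_solutions b p T y. s (Suc T) \<le> x) \<longrightarrow> V y \<le> V x) \<and>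
        ((\<forall>x\<in>{0..b}. \<forall>y\<in>{0..b}. y \<ge> x \<longrightarrow>
           (\<exists>s\<in>cake_solutions b p T y. s (Suc T) \<le> x)) \<longrightarrow>
         (\<forall>x\<in>{0..b}. V b \<le> V x \<and> V x \<le> V 0))) \<and>
     (p T < 0 \<longrightarrow>
        (\<forall>x\<in>{0..b}. \<forall>y\<in>{0..b}. y > x \<longrightarrow>
           (\<exists>s\<in>cake_solutions b p T y. s (Suc T) \<le> x) \<longrightarrow> V y < V x)) \<and>
     ((\<forall>x\<in>{0<..<b}. (\<exists>D. (V has_real_derivative D) (at_left x)) \<and>
                      (\<exists>D. (V has_real_derivative D) (at_right x))) \<and>
      antimono_on {0<..<b} (left_deriv V) \<and>
      antimono_on {0<..<b} (right_deriv V) \<and>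
      (\<forall>x\<in>{0<..<b}. \<forall>y\<in>{0..b}.
         V y - left_deriv V x * y \<le> V x - left_deriv V x * x)) \<and>
     (p T \<ge> 0 \<longrightarrow>
        (\<exists>D. (V has_real_derivative D) (at_left b)) \<and>
        left_deriv V b \<ge> 0 \<and>
        (\<forall>x\<in>{0<..b}. left_deriv V x \<ge> left_deriv V b) \<and>
        (\<forall>y\<in>{0..b}. V y - left_deriv V b * y \<le> V b - left_deriv V b * b))"
proof -
  obtain c where pc: "p T \<le> c" and V: "\<And>y. y \<in> {0..b} \<Longrightarrow> V y = c * y"
    and bound: "\<And>x y. x \<in> cake_feasible b T y \<Longrightarrow> cake_objective p T x \<le> c * y"
    unfolding V_def using cake_value_linear[OF assms(2)] by metis
  have left: "(V has_real_derivative c) (at_left x)" if "x \<in> {0<..b}" for x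
    using V that by (rule linear_has_left_derivative)
  have right: "(V has_real_derivative c) (at_right x)" if "x \<in> {0<..<b}" for x
    using V that by (intro linear_has_right_derivative[of 0 b]) auto
  note deriv_eqs = left_deriv_eqI[OF left] right_deriv_eqI[OF right]
  \<comment> \<open>An optimal plan from \<open>y\<close> whose next stock is at most
    \<open>x\<close> can be restarted at \<open>x\<close>; its objective changes only in the first
    term, and the result is a candidate for the problem at \<open>x\<close>.\<close>
  have keep: "V y + p T * (x - y) \<le> V x"
    if "x \<in> {0..b}" "s \<in> cake_solutions b p T y" "s (Suc T) \<le> x" for x y s
  proof -
    have s: "s \<in> cake_feasible b T y"
      using that(2) by (simp add: cake_solutions_def)
    have s': "s(T := x) \<in> cake_feasible b T x"
      using s that(1,3) by (rule cake_feasible_lower_start)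
    have "V y = cake_objective p T s"
      unfolding V_def using that(2) by (rule cake_value_eq)
    then show ?thesis
      using bound[OF s'] cake_objective_update_start[OF assms(2) s s'] V[OF that(1)] by simp
  qed
  have noninc: "V y \<le> V x"
    if "p T \<le> 0" "x \<in> {0..b}" "x \<le> y" "\<exists>s\<in>cake_solutions b p T y. s (Suc T) \<le> x" for x y
  proof -
    have "0 \<le> p T * (x - y)"
      using that(1,3) by (intro mult_nonpos_nonpos) auto
    with keep that(2,4) show ?thesis by fastforce
  qed
  have dec: "V y < V x"
    if "p T < 0" "x \<in> {0..b}" "x < y" "\<exists>s\<in>cake_solutions b p T y. s (Suc T) \<le> x" for x y
  proof -
    have "0 < p T * (x - y)"
      using that(1,3) by (intro mult_neg_neg) auto
    with keep that(2,4) show ?thesis by fastforce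
  qed
  \<comment> \<open>The slope inherits its sign from \<open>p T\<close>, because
    \<open>p T \<le> c\<close>.\<close>
  have mono: "V x \<le> V y" if "0 \<le> p T" "x \<in> {0..b}" "y \<in> {0..b}" "x \<le> y" for x y
    using that pc by (simp add: V mult_left_mono)
  have strict: "V x < V y" if "0 < p T" "x \<in> {0..b}" "y \<in> {0..b}" "x < y" for x y
    using that pc by (simp add: V)
  have ends: "0 \<in> {0..b}" "b \<in> {0..b}" "b \<in> {0<..b}"
    using assms(1) by auto
  show ?thesis
  proof (intro conjI impI ballI)
    \<comment> \<open>Both one-sided derivatives are constantly \<open>c\<close> on the open
      interval.\<close>
    show "antimono_on {0<..<b} (left_deriv V)" "antimono_on {0<..<b} (right_deriv V)"
      by (auto simp: monotone_on_def deriv_eqs)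
  next
    show "\<exists>D. (V has_real_derivative D) (at_left x)"
      "\<exists>D. (V has_real_derivative D) (at_right x)" if "x \<in> {0<..<b}" for x
      using left[of x] right[of x] that by auto
  next
    show "\<exists>D. (V has_real_derivative D) (at_left b)"
      using left ends by blast
  next
    fix x y
    assume "p T \<le> 0" "x \<in> {0..b}" "x \<le> y" "\<exists>s\<in>cake_solutions b p T y. s (Suc T) \<le> x"
    then show "V y \<le> V x" by (rule noninc)
  next
    \<comment> \<open>The hypothesis is applied to the pairs \<open>x \<le> b\<close> and
      \<open>0 \<le> x\<close>.\<close>
    fix x
    assume *: "p T \<le> 0" "x \<in> {0..b}" "\<forall>x\<in>{0..b}. \<forall>y\<in>{0..b}. y \<ge> x \<longrightarrow>
      (\<exists>s\<in>cake_solutions b p T y. s (Suc T) \<le> x)"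
    then show "V b \<le> V x" using noninc[of x b] ends by simp
    show "V x \<le> V 0" using * noninc[of 0 x] ends by simp
  next
    fix x y
    assume "p T < 0" "x \<in> {0..b}" "x < y" "\<exists>s\<in>cake_solutions b p T y. s (Suc T) \<le> x"
    then show "V y < V x" by (rule dec)
  next
    \<comment> \<open>Both sides are 0, as \<open>V\<close> is linear with slope
      \<open>c\<close>.\<close>
    fix x y assume "x \<in> {0<..<b}" "y \<in> {0..b}"
    then show "V y - left_deriv V x * y \<le> V x - left_deriv V x * x"
      by (simp add: V deriv_eqs)
  \<comment> \<open>What remains is monotonicity for non-negative or positive \<open>p T\<close>,
    and the claims on the left derivative at \<open>b\<close>, which equals \<open>c\<close> and so
    is at least \<open>p T\<close>.\<close>
  qed (use mono strict ends pc in \<open>auto simp: deriv_eqs V\<close>)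
qed

end
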